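(* Consider any feasible path for Problem (Pmc), i.e., any path satisfying the constraints of Problem (Pmc), which in each stage $i$, $i=1,\dots,N$, is of type $CC$ or $C$, where the length of any subarc $C$ is not greater than $\pi/a$. Suppose that the following system of equalities and inequalities has a solution for $\rho_i$ and $\phi_i$, for all $i=1,\dots,N$ (with $\lambda_0=0$). For each intermediate node $i=1,\dots,N-1$: $$\rho_{i+1}\cos(\theta(t_i)-\phi_{i+1})=\rho_i\cos(\theta(t_i)-\phi_i)\quad\text{if } u(t_i^+)=u(t_i^-),$$ $$\rho_{i+1}\cos(\theta(t_i)-\phi_{i+1})=-\rho_i\cos(\theta(t_i)-\phi_i)\quad\text{if } u(t_i^+)=-u(t_i^-);$$ and, along the curve segment in each stage $i=1,\dots,N$: - $\rho_i>0$ and $\phi_i=\theta_1^i\pm\pi/2$, for type $CC$; - $\rho_i>0$ and $\phi_i=\theta_0^i+\operatorname{sgn}(u(t_{i-1}^+))\,\pi/2$, for type $C$. Then the path verifies the maximum principle (with $\lambda_0=0$).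
   Context: Fix an integer $N\ge1$, a real $a>0$, points $p_i=(x_i,y_i)\in\mathbb{R}^2$, $i=0,\dots,N$, with $p_{i-1}\neq p_i$, and angles $\theta_0,\theta_f\in\mathbb{R}$. Problem (Pc): minimize $t_N$ over node times $0=t_0<t_1<\dots<t_N$ (free), measurable controls $u$ with $|u(t)|\le a$ a.e., and states $x,y,\theta$ with $\dot x=\cos\theta$, $\dot y=\sin\theta$, $\dot\theta=u$ on $[0,t_N]$, $(x(t_i),y(t_i))=p_i$ for $i=0,\dots,N$, $\theta(0)=\theta_0$, $\theta(t_N)=\theta_f$. Problem (Pmc) is the equivalent multistage form of (Pc) obtained by rescaling each stage $[t_{i-1},t_i]$ to $[0,1]$ via $t=t_{i-1}+s\tau_i$, $\tau_i=t_i-t_{i-1}>0$, with continuity of $x,y,\theta$ imposed at the junctions; feasible paths of the two problems correspond to each other. Types: $C$ is a circular arc of positive length with $u\equiv a$ or $u\equiv-a$; type $CC$ in a stage is a concatenation of two such arcs with opposite signs of $u$. Stage $i$ is the part of the path over $[t_{i-1},t_i]$. For type $CC$, $t_1^i\in(t_{i-1},t_i)$ is the switching time in stage $i$ and $\theta_1^i:=\theta(t_1^i)$. Also $\theta_0^i:=\theta(t_{i-1})$, and $u(t_i^\pm)$ are one-sided limits of $u$. Maximum principle: a feasible path with node times $t_i$ verifies the maximum principle (is stationary) if there exist a number $\lambda_0\ge0$, real constants $\overline\lambda_1^i,\overline\lambda_2^i$ ($i=1,\dots,N$), and a continuous function $\lambda_3:[0,t_N]\to\mathbb{R}$, Lipschitz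 on each stage, such that for every $i=1,\dots,N$: (1) $(\lambda_0,\overline\lambda_1^i,\overline\lambda_2^i,\lambda_3(t))\neq 0$ for all $t\in[t_{i-1},t_i]$; (2) $\dot\lambda_3(t)=\overline\lambda_1^i\sin\theta(t)-\overline\lambda_2^i\cos\theta(t)$ on $[t_{i-1},t_i]$; (3) for a.e. $t\in[t_{i-1},t_i)$, $u(t)=a$ if $\lambda_3(t)<0$, $u(t)=-a$ if $\lambda_3(t)>0$ ($u(t)$ is undetermined in $[-a,a]$ if $\lambda_3(t)=0$); (4) $\lambda_0+\overline\lambda_1^i\cos\theta(t)+\overline\lambda_2^i\sin\theta(t)+\lambda_3(t)u(t)=0$ on $[t_{i-1},t_i)$. Here $\rho_i$ and $\phi_i$ are the polar coordinates of the constants: $\overline\lambda_1^i=\rho_i\cos\phi_i$, $\overline\lambda_2^i=\rho_i\sin\phi_i$, $\rho_i\ge 0$. The path is called abnormal when $\lambda_0=0$.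
   Formalization: For type CC the sign in φ_i = θ_1^i ± π/2 is not free: it is + when u switches from −a to a and − when u switches from a to −a; with freely chosen signs the claim fails already for N = 2. *)

theory Defs
  imports "HOL-Analysis.Analysis"
begin

text \<open>
  The controls are bounded, so the absolutely continuous state trajectories are exactly the
  Lipschitz functions that satisfy the differential equation almost everywhere.
\<close>

definition stage_ode :: "(real \<Rightarrow> real) \<Rightarrow> (real \<Rightarrow> real) \<Rightarrow> bool" where
  "stage_ode f g \<longleftrightarrow>
     (\<exists>L. L-lipschitz_on {0..1} f) \<and>
     (AE s in lebesgue_on {0..1}. (f has_real_derivative g s) (at s within {0..1}))"

text \<open>
  The stages are numbered from 1 to N; \<open>X i\<close>, \<open>Y i\<close>, \<open>\<Theta> i\<close> are the states and \<open>U i\<close> the control of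
  stage i, as functions of the rescaled time in [0,1], and \<open>\<tau> i\<close> is the duration of stage i.
\<close>

definition Pmc_feasible ::
  "nat \<Rightarrow> real \<Rightarrow> (nat \<Rightarrow> real \<times> real) \<Rightarrow> real \<Rightarrow> real \<Rightarrow> (nat \<Rightarrow> real) \<Rightarrow>
   (nat \<Rightarrow> real \<Rightarrow> real) \<Rightarrow> (nat \<Rightarrow> real \<Rightarrow> real) \<Rightarrow> (nat \<Rightarrow> real \<Rightarrow> real) \<Rightarrow> (nat \<Rightarrow> real \<Rightarrow> real) \<Rightarrow> bool"
where
  "Pmc_feasible N a p th_init th_fin \<tau> X Y \<Theta> U \<longleftrightarrow>
     (\<forall>i\<in>{1..N}.
        \<tau> i > 0 \<and>
        U i \<in> borel_measurable (lebesgue_on {0..1}) \<and>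
        (AE s in lebesgue_on {0..1}. \<bar>U i s\<bar> \<le> a) \<and>
        stage_ode (X i) (\<lambda>s. \<tau> i * cos (\<Theta> i s)) \<and>
        stage_ode (Y i) (\<lambda>s. \<tau> i * sin (\<Theta> i s)) \<and>
        stage_ode (\<Theta> i) (\<lambda>s. \<tau> i * U i s)) \<and>
     (\<forall>i\<in>{1..<N}. X (i + 1) 0 = X i 1 \<and> Y (i + 1) 0 = Y i 1 \<and> \<Theta> (i + 1) 0 = \<Theta> i 1) \<and>
     (X 1 0, Y 1 0) = p 0 \<and>
     (\<forall>i\<in>{1..N}. (X i 1, Y i 1) = p i) \<and>
     \<Theta> 1 0 = th_init \<and> \<Theta> N 1 = th_fin"

definition node_time :: "(nat \<Rightarrow> real) \<Rightarrow> nat \<Rightarrow> real" where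
  "node_time \<tau> i = (\<Sum>j=1..i. \<tau> j)"

text \<open>
  The stagewise functions \<open>F 1, \<dots>, F N\<close> joined to one function of the original time in
  \<open>[0, node_time \<tau> N]\<close>. At an intermediate node the later stage is used; this affects only the
  control, since the states agree there.
\<close>

definition concatenate :: "nat \<Rightarrow> (nat \<Rightarrow> real) \<Rightarrow> (nat \<Rightarrow> real \<Rightarrow> real) \<Rightarrow> real \<Rightarrow> real" where
  "concatenate N \<tau> F t =
     (let i = (if t < node_time \<tau> N then LEAST i. t < node_time \<tau> i else N)
      in F i ((t - node_time \<tau> (i - 1)) / \<tau> i))"

text \<open>
  Arcs include their initial but not their final time. Controls matter only up to null sets, so this
  merely selects the right-continuous representative of a bang-bang control; it is needed because
  the Hamiltonian condition of the maximum principle is required at every time of a half-open stage.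
  The paths have unit speed, so the length of an arc is its duration.
\<close>

definition arc_with :: "(real \<Rightarrow> real) \<Rightarrow> real \<Rightarrow> real \<Rightarrow> real \<Rightarrow> bool" where
  "arc_with u b s e \<longleftrightarrow> s < e \<and> (\<forall>t\<in>{s..<e}. u t = b)"

definition type_C :: "real \<Rightarrow> (real \<Rightarrow> real) \<Rightarrow> real \<Rightarrow> real \<Rightarrow> bool" where
  "type_C a u s e \<longleftrightarrow> arc_with u a s e \<or> arc_with u (- a) s e"

definition type_CC :: "real \<Rightarrow> (real \<Rightarrow> real) \<Rightarrow> real \<Rightarrow> real \<Rightarrow> real \<Rightarrow> bool" where
  "type_CC a u s m e \<longleftrightarrow>
     (arc_with u a s m \<and> arc_with u (- a) m e) \<or> (arc_with u (- a) s m \<and> arc_with u a m e)"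

definition right_limit :: "(real \<Rightarrow> real) \<Rightarrow> real \<Rightarrow> real" where
  "right_limit u t = Lim (at_right t) u"

definition left_limit :: "(real \<Rightarrow> real) \<Rightarrow> real \<Rightarrow> real" where
  "left_limit u t = Lim (at_left t) u"

definition multipliers ::
  "nat \<Rightarrow> real \<Rightarrow> (nat \<Rightarrow> real) \<Rightarrow> (real \<Rightarrow> real) \<Rightarrow> (real \<Rightarrow> real) \<Rightarrow>
   real \<Rightarrow> (nat \<Rightarrow> real) \<Rightarrow> (nat \<Rightarrow> real) \<Rightarrow> (real \<Rightarrow> real) \<Rightarrow> bool"
where
  "multipliers N a t \<theta> u l0 l1 l2 l3 \<longleftrightarrow>
     l0 \<ge> 0 \<and>
     continuous_on {0..t N} l3 \<and>
     (\<forall>i\<in>{1..N}.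
        (\<exists>L. L-lipschitz_on {t (i - 1)..t i} l3) \<and>
        (\<forall>r\<in>{t (i - 1)..t i}. (l0, l1 i, l2 i, l3 r) \<noteq> (0, 0, 0, 0)) \<and>
        (\<forall>r\<in>{t (i - 1)..t i}.
           (l3 has_real_derivative l1 i * sin (\<theta> r) - l2 i * cos (\<theta> r))
             (at r within {t (i - 1)..t i})) \<and>
        (AE r in lebesgue_on {t (i - 1)..<t i}.
           (l3 r < 0 \<longrightarrow> u r = a) \<and> (l3 r > 0 \<longrightarrow> u r = - a)) \<and>
        (\<forall>r\<in>{t (i - 1)..<t i}.
           l0 + l1 i * cos (\<theta> r) + l2 i * sin (\<theta> r) + l3 r * u r = 0))"

definition verifies_max_principle_with ::
  "real \<Rightarrow> nat \<Rightarrow> real \<Rightarrow> (nat \<Rightarrow> real) \<Rightarrow> (real \<Rightarrow> real) \<Rightarrow> (real \<Rightarrow> real) \<Rightarrow> bool"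
where
  "verifies_max_principle_with l0 N a t \<theta> u \<longleftrightarrow> (\<exists>l1 l2 l3. multipliers N a t \<theta> u l0 l1 l2 l3)"

definition node_conditions ::
  "nat \<Rightarrow> (nat \<Rightarrow> real) \<Rightarrow> (real \<Rightarrow> real) \<Rightarrow> (real \<Rightarrow> real) \<Rightarrow> (nat \<Rightarrow> real) \<Rightarrow> (nat \<Rightarrow> real) \<Rightarrow> bool"
where
  "node_conditions N t \<theta> u \<rho> \<phi> \<longleftrightarrow>
     (\<forall>i\<in>{1..<N}.
        (right_limit u (t i) = left_limit u (t i) \<longrightarrow>
           \<rho> (i + 1) * cos (\<theta> (t i) - \<phi> (i + 1)) = \<rho> i * cos (\<theta> (t i) - \<phi> i)) \<and>
        (right_limit u (t i) = - left_limit u (t i) \<longrightarrow>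
           \<rho> (i + 1) * cos (\<theta> (t i) - \<phi> (i + 1)) = - (\<rho> i * cos (\<theta> (t i) - \<phi> i))))"

text \<open>
  \<open>m i\<close> is the switching time of stage i when this stage is of type CC, and is irrelevant otherwise.

  For type CC the angle is \<open>\<phi> i = \<theta> (m i) \<plusminus> pi/2\<close>, where the sign is not free but determined by the
  sense of the turn: it is + when the control switches from -a to a, and - when it switches from
  a to -a. This is the sign for which \<open>cos (\<theta> - \<phi> i)\<close> is nonnegative along the stage, as the
  maximum principle requires when the multiplier of the cost is 0.
\<close>

definition stage_conditions ::
  "nat \<Rightarrow> real \<Rightarrow> (nat \<Rightarrow> real) \<Rightarrow> (nat \<Rightarrow> real) \<Rightarrow> (real \<Rightarrow> real) \<Rightarrow> (real \<Rightarrow> real) \<Rightarrow>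
   (nat \<Rightarrow> real) \<Rightarrow> (nat \<Rightarrow> real) \<Rightarrow> bool"
where
  "stage_conditions N a t m \<theta> u \<rho> \<phi> \<longleftrightarrow>
     (\<forall>i\<in>{1..N}.
        (type_CC a u (t (i - 1)) (m i) (t i) \<longrightarrow>
           \<rho> i > 0 \<and> \<phi> i = \<theta> (m i) + sgn (right_limit u (m i)) * (pi / 2)) \<and>
        (type_C a u (t (i - 1)) (t i) \<longrightarrow>
           \<rho> i > 0 \<and> \<phi> i = \<theta> (t (i - 1)) + sgn (right_limit u (t (i - 1))) * (pi / 2)))"

end

theory Submission
  imports Defs
begin

text \<open>
  A stage with final control \<open>b\<close> has a pivot \<open>q\<close>: the switching time for type CC, the initial time for
  type C. In both cases \<open>\<theta> r = \<theta> q + b * \<bar>r - q\<bar>\<close>, the prescribed \<open>\<phi>\<close> is \<open>\<theta> q + sgn b * (pi / 2)\<close>, and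
  \<open>\<lambda>\<^sub>3 r = - (\<rho> / b) * sin (a * (r - q))\<close> solves the adjoint equation. The bound \<open>pi / a\<close> on the arcs gives
  \<open>\<lambda>\<^sub>3 * u \<le> 0\<close>. Since \<open>\<lambda>\<^sub>3 * u = - \<rho> * cos (\<theta> - \<phi>)\<close>, the node conditions say exactly that these
  functions agree at the nodes.
\<close>

section \<open>Fundamental theorem of calculus for Lipschitz functions differentiable almost
  everywhere\<close>

text \<open>
  Where the derivative exists the increments are controlled by differentiability; on the exceptional
  set by the Lipschitz constant, and there the gauge makes the total length of the tagged intervals
  small.
\<close>

lemma lipschitz_has_integral_derivative:
  fixes f f' :: "real \<Rightarrow> real"
  assumes "a \<le> b" and lip: "L-lipschitz_on {a..b} f" and neg: "negligible S"
    and der: "\<And>x. x \<in> {a..b} - S \<Longrightarrow> (f has_real_derivative f' x) (at x within {a..b})"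
  shows "(f' has_integral f b - f a) {a..b}"
proof -
  \<comment> \<open>With value 0 on \<open>S\<close>, a tag in \<open>S\<close> leaves only the
    increment of \<open>f\<close>, which the Lipschitz constant bounds. The final spike over
    \<open>S\<close> restores \<open>f'\<close>.\<close>
  define g where "g x = (if x \<in> S then 0 else f' x)" for x
  have L: "0 \<le> L" using lip by (rule lipschitz_on_nonneg)
  have "(g has_integral f b - f a) {a..b}"
    unfolding has_integral_real
  proof (intro allI impI)
    fix e :: real assume "e > 0"
    \<comment> \<open>Each kind of tag gets half of \<open>e\<close>. The added 1 keeps the
      denominators positive when \<open>b = a\<close> or \<open>L = 0\<close>.\<close>
    define e1 where "e1 = e / (2 * (b - a + 1))"
    define e2 where "e2 = e / (2 * (L + 1))"
    have "e1 > 0" "e2 > 0" using \<open>e > 0\<close> \<open>a \<le> b\<close> L by (auto simp: e1_def e2_def)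
    have "\<forall>x. \<exists>d>0. x \<in> {a..b} - S \<longrightarrow>
         (\<forall>y\<in>{a..b}. norm (y-x) < d \<longrightarrow> norm (f y - f x - f' x * (y - x)) \<le> e1 * norm (y-x))"
      using der[unfolded has_field_derivative_def has_derivative_within_alt] \<open>e1 > 0\<close>
      by (metis zero_less_one)
    then obtain d where d: "\<And>x. 0 < d x"
      "\<And>x y. \<lbrakk>x \<in> {a..b}; x \<notin> S; y \<in> {a..b}; \<bar>y - x\<bar> < d x\<rbrakk>
                        \<Longrightarrow> \<bar>f y - f x - f' x * (y - x)\<bar> \<le> e1 * \<bar>y - x\<bar>"
      by (metis DiffI real_norm_def)
    \<comment> \<open>The Riemann sums of this null integral are the total lengths of the intervals
      tagged in \<open>S\<close>; the gauge \<gamma> makes them smaller than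
      \<open>e2\<close>.\<close>
    have "(indicat_real S has_integral 0) {a..b}"
      using neg by (simp add: negligible)
    then obtain \<gamma> where \<gamma>: "gauge \<gamma>"
      "\<And>p. \<lbrakk>p tagged_division_of {a..b}; \<gamma> fine p\<rbrakk> \<Longrightarrow>
         \<bar>\<Sum>(x,K)\<in>p. measure lborel K * indicat_real S x\<bar> < e2"
      unfolding has_integral_real using \<open>e2 > 0\<close> by force
    show "\<exists>\<gamma>. gauge \<gamma> \<and>
             (\<forall>p. p tagged_division_of {a..b} \<and> \<gamma> fine p \<longrightarrow>
                norm ((\<Sum>(x, K)\<in>p. measure lborel K *\<^sub>R g x) - (f b - f a)) < e)"
    proof (intro exI[of _ "\<lambda>x. ball x (d x) \<inter> \<gamma> x"] conjI allI impI; (elim conjE)?)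
      show "gauge (\<lambda>x. ball x (d x) \<inter> \<gamma> x)"
        using d(1) \<gamma>(1) by (intro gauge_Int gauge_ball_dependent) auto
    next
      fix p assume ptag: "p tagged_division_of {a..b}" and fine: "(\<lambda>x. ball x (d x) \<inter> \<gamma> x) fine p"
      have finep: "(\<lambda>x. ball x (d x)) fine p" and "\<gamma> fine p"
        using fine by (auto simp: fine_Int)
      have ba: "(\<Sum>(x,K)\<in>p. Sup K - Inf K) = b - a" "(\<Sum>(x,K)\<in>p. f(Sup K) - f(Inf K)) = f b - f a"
        using additive_tagged_division_1[where f= "\<lambda>x. x"] additive_tagged_division_1[where f= f]
            \<open>a \<le> b\<close> ptag by auto
      have "norm (\<Sum>(x,K)\<in>p. measure lborel K *\<^sub>R g x - (f (Sup K) - f (Inf K)))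
          \<le> (\<Sum>n\<in>p. case n of (x, K) \<Rightarrow> e1 * (Sup K - Inf K) + L * (measure lborel K * indicat_real S x))"
      proof (rule sum_norm_le, safe)
        fix x K
        assume xK: "(x, K) \<in> p"
        then have "x \<in> K" and kab: "K \<subseteq> cbox a b"
          using tagged_division_ofD(2,3)[OF ptag] by auto
        then obtain u v where k: "K = cbox u v"
          using ptag xK by (metis tagged_division_ofD(4))
        have "u \<le> v" and uxv: "u \<le> x" "x \<le> v"
          using \<open>x \<in> K\<close> by (auto simp: k)
        have uv: "u \<in> {a..b}" "v \<in> {a..b}" "x \<in> {a..b}"
          using kab \<open>u \<le> v\<close> uxv by (auto simp: k)
        have ball: "\<And>y. y \<in> K \<Longrightarrow> \<bar>y - x\<bar> < d x"
          using finep xK by (force simp: fine_def dist_real_def)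
        have "u \<in> K" "v \<in> K"
          by (simp_all add: \<open>u \<le> v\<close> k)
        have "\<bar>(v - u) * g x - (f v - f u)\<bar> \<le> e1 * (v - u) + L * ((v - u) * indicat_real S x)"
        proof (cases "x \<in> S")
          case True
          have "\<bar>f v - f u\<bar> \<le> L * (v - u)"
            using lipschitz_onD[OF lip uv(2,1)] \<open>u \<le> v\<close> by (simp add: dist_real_def)
          moreover have "0 \<le> e1 * (v - u)" using \<open>e1 > 0\<close> \<open>u \<le> v\<close> by simp
          ultimately show ?thesis using True by (simp add: g_def)
        next
          case False
          \<comment> \<open>The tag splits \<open>[u, v]\<close> into \<open>[u, x]\<close> and
            \<open>[x, v]\<close>, so the errors at both ends add up to
            \<open>e1 * (v - u)\<close>.\<close>
          have "\<bar>f u - f x - f' x * (u - x)\<bar> \<le> e1 * (x - u)" "\<bar>f v - f x - f' x * (v - x)\<bar> \<le> e1 * (v - x)"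
            using d(2)[OF uv(3) False uv(1) ball[OF \<open>u \<in> K\<close>]]
              d(2)[OF uv(3) False uv(2) ball[OF \<open>v \<in> K\<close>]] uxv by auto
          moreover have "(v - u) * f' x - (f v - f u) =
              (f u - f x - f' x * (u - x)) - (f v - f x - f' x * (v - x))"
            by (simp add: algebra_simps)
          moreover have "e1 * (v - u) = e1 * (x - u) + e1 * (v - x)"
            by (simp add: algebra_simps)
          ultimately show ?thesis using False by (simp add: g_def)
        qed
        then show "norm (measure lborel K *\<^sub>R g x - (f (Sup K) - f (Inf K)))
            \<le> e1 * (Sup K - Inf K) + L * (measure lborel K * indicat_real S x)"
          using \<open>u \<le> v\<close> by (simp add: k)
      qed
      also have "\<dots> = e1 * (\<Sum>(x,K)\<in>p. Sup K - Inf K) + L * (\<Sum>(x,K)\<in>p. measure lborel K * indicat_real S x)"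
        by (simp add: split_def sum.distrib sum_distrib_left)
      also have "\<dots> \<le> e1 * (b - a) + L * e2"
        using \<gamma>(2)[OF ptag \<open>\<gamma> fine p\<close>] L \<open>e1 > 0\<close> unfolding ba by (intro add_mono mult_left_mono) auto
      also have "\<dots> < e1 * (b - a + 1) + (L + 1) * e2"
        using \<open>e1 > 0\<close> \<open>e2 > 0\<close> by (simp add: algebra_simps)
      also have "e1 * (b - a + 1) = e / 2"
        using \<open>a \<le> b\<close> by (simp add: e1_def field_simps)
      also have "(L + 1) * e2 = e / 2"
        using L by (simp add: e2_def field_simps)
      finally show "norm ((\<Sum>(x, K)\<in>p. measure lborel K *\<^sub>R g x) - (f b - f a)) < e"
        by (simp add: split_def sum_subtractf flip: ba(2))
    qed
  qed
  then show ?thesis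
    by (rule has_integral_spike[OF neg, rotated]) (simp add: g_def)
qed

text \<open>The derivative equals \<open>c\<close> off a null set, so integrating it gives linear
  growth. Arcs being half-open, the end point \<open>e\<close> has to join the exceptional
  set.\<close>

lemma stage_ode_constant_rate:
  assumes ode: "stage_ode f g" and "0 \<le> s" "s \<le> e" "e \<le> 1"
    and g: "\<And>x. x \<in> {s..<e} \<Longrightarrow> g x = c"
  shows "f e - f s = c * (e - s)"
proof -
  obtain L where L: "L-lipschitz_on {0..1} f"
    using ode by (auto simp: stage_ode_def)
  have "AE x in lebesgue. x \<in> {0..1} \<longrightarrow> (f has_real_derivative g x) (at x within {0..1})"
    using ode by (simp add: stage_ode_def AE_restrict_space_iff)
  then obtain S where S: "negligible S"
    "\<And>x. \<lbrakk>x \<in> {0..1}; x \<notin> S\<rbrakk> \<Longrightarrow> (f has_real_derivative g x) (at x within {0..1})"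
    unfolding eventually_ae_filter_negligible by blast
  have sub: "{s..e} \<subseteq> {0..1}" using assms by auto
  have "((\<lambda>_. c) has_integral f e - f s) {s..e}"
  proof (rule lipschitz_has_integral_derivative[OF \<open>s \<le> e\<close>])
    show "L-lipschitz_on {s..e} f" using L sub by (rule lipschitz_on_subset)
    show "negligible (insert e S)" using S(1) by simp
    fix x assume x: "x \<in> {s..e} - insert e S"
    then have "g x = c" using g by force
    then show "(f has_real_derivative c) (at x within {s..e})"
      using S(2)[of x] x sub by (auto intro: DERIV_subset)
  qed
  moreover have "((\<lambda>_. c) has_integral c * (e - s)) {s..e}"
    using has_integral_const_real[of c s e] \<open>s \<le> e\<close> by (simp add: mult.commute)
  ultimately show ?thesis by (rule has_integral_unique)
qed

section \<open>Node times and the joining of stages\<close>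

lemma node_time_Suc: "node_time \<tau> (Suc i) = node_time \<tau> i + \<tau> (Suc i)"
  by (simp add: node_time_def)

lemma node_time_stage: "i \<ge> 1 \<Longrightarrow> node_time \<tau> i = node_time \<tau> (i - 1) + \<tau> i"
  using node_time_Suc[of \<tau> "i - 1"] by simp

lemma node_time_0 [simp]: "node_time \<tau> 0 = 0"
  by (simp add: node_time_def)

lemma node_time_mono:
  assumes "\<And>j. j \<in> {1..N} \<Longrightarrow> \<tau> j > 0" and "i \<le> j" "j \<le> N"
  shows "node_time \<tau> i \<le> node_time \<tau> j"
  unfolding node_time_def using assms by (intro sum_mono2) (auto intro: less_imp_le)

text \<open>Node times increase, so every index below \<open>i\<close> has a node time at most
  \<open>r\<close>, and the \<open>LEAST\<close> in \<open>concatenate\<close> is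
  \<open>i\<close>.\<close>

lemma concatenate_stage:
  assumes pos: "\<And>j. j \<in> {1..N} \<Longrightarrow> \<tau> j > 0" and i: "i \<in> {1..N}"
    and r: "r \<in> {node_time \<tau> (i - 1)..<node_time \<tau> i}"
  shows "concatenate N \<tau> F r = F i ((r - node_time \<tau> (i - 1)) / \<tau> i)"
proof -
  have "(LEAST i. r < node_time \<tau> i) = i"
  proof (rule Least_equality)
    fix j assume "r < node_time \<tau> j"
    then have "\<not> j \<le> i - 1" using node_time_mono[OF pos, where i = j and j = "i - 1"] i r by force
    then show "i \<le> j" by simp
  qed (use r in simp)
  moreover have "r < node_time \<tau> N"
    using node_time_mono[OF pos, where i = i and j = N] i r by force
  ultimately show ?thesis by (simp add: concatenate_def)
qed

text \<open>At an intermediate closing node \<open>concatenate\<close> already reads the next stage,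
  at its rescaled time 0; \<open>glue\<close> turns this into the value of stage \<open>i\<close> at
  1. At the last node the default branch reads stage \<open>N\<close> itself.\<close>

lemma concatenate_closed_stage:
  assumes pos: "\<And>j. j \<in> {1..N} \<Longrightarrow> \<tau> j > 0" and i: "i \<in> {1..N}"
    and glue: "\<And>j. j \<in> {1..<N} \<Longrightarrow> F (j + 1) 0 = F j 1"
    and r: "r \<in> {node_time \<tau> (i - 1)..node_time \<tau> i}"
  shows "concatenate N \<tau> F r = F i ((r - node_time \<tau> (i - 1)) / \<tau> i)"
proof (cases "r < node_time \<tau> i")
  case True
  then show ?thesis using r by (intro concatenate_stage[OF pos i]) auto
next
  case False
  then have r: "r = node_time \<tau> i" using r by simp
  have "\<tau> i > 0" using pos i by blast
  then have end1: "(r - node_time \<tau> (i - 1)) / \<tau> i = 1"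
    using i r by (simp add: node_time_stage)
  show ?thesis
  proof (cases "i = N")
    case True
    then show ?thesis using r by (simp add: concatenate_def)
  next
    case False
    then have "i \<in> {1..<N}" "i + 1 \<in> {1..N}" using i by auto
    moreover have "r \<in> {node_time \<tau> (i + 1 - 1)..<node_time \<tau> (i + 1)}"
      using pos[OF \<open>i + 1 \<in> {1..N}\<close>] r by (simp add: node_time_Suc)
    ultimately have "concatenate N \<tau> F r = F (i + 1) ((r - node_time \<tau> i) / \<tau> (i + 1))"
      using concatenate_stage[OF pos, where i = "i + 1" and F = F] by simp
    then show ?thesis using glue[OF \<open>i \<in> {1..<N}\<close>] end1 r by simp
  qed
qed

lemma continuous_on_consecutive:
  fixes f :: "real \<Rightarrow> 'a::topological_space" and T :: "nat \<Rightarrow> real"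
  assumes mono: "\<And>i. i \<in> {1..n} \<Longrightarrow> T (i - 1) \<le> T i"
    and cont: "\<And>i. i \<in> {1..n} \<Longrightarrow> continuous_on {T (i - 1)..T i} f"
  shows "continuous_on {T 0..T n} f"
proof -
  have "k \<le> n \<longrightarrow> T 0 \<le> T k \<and> continuous_on {T 0..T k} f" for k
  proof (induction k)
    case (Suc k)
    show ?case
    proof
      assume k: "Suc k \<le> n"
      then have IH: "T 0 \<le> T k" "continuous_on {T 0..T k} f" using Suc by auto
      have next_piece: "T k \<le> T (Suc k)" "continuous_on {T k..T (Suc k)} f"
        using mono[of "Suc k"] cont[of "Suc k"] k by auto
      have "{T 0..T (Suc k)} = {T 0..T k} \<union> {T k..T (Suc k)}"
        using IH(1) next_piece(1) by auto
      then show "T 0 \<le> T (Suc k) \<and> continuous_on {T 0..T (Suc k)} f"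
        using continuous_on_closed_Un[OF _ _ IH(2) next_piece(2)] IH(1) next_piece(1) by auto
    qed
  qed simp
  then show ?thesis by blast
qed

text \<open>Rescaling multiplies the rate by \<open>\<tau> i\<close> and divides the duration by it,
  so the factors cancel on an arc inside one stage. The control is needed only on the half-open arc,
  the angle also at \<open>e\<close>, which may be a node.\<close>

lemma concatenate_arc:
  assumes pos: "\<And>j. j \<in> {1..N} \<Longrightarrow> \<tau> j > 0" and i: "i \<in> {1..N}"
    and glue: "\<And>j. j \<in> {1..<N} \<Longrightarrow> \<Theta> (j + 1) 0 = \<Theta> j 1"
    and ode: "stage_ode (\<Theta> i) (\<lambda>s. \<tau> i * U i s)"
    and "node_time \<tau> (i - 1) \<le> s" "s \<le> e" "e \<le> node_time \<tau> i"
    and u: "\<And>r. r \<in> {s..<e} \<Longrightarrow> concatenate N \<tau> U r = b"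
  shows "concatenate N \<tau> \<Theta> e - concatenate N \<tau> \<Theta> s = b * (e - s)"
proof -
  define h where "h r = (r - node_time \<tau> (i - 1)) / \<tau> i" for r
  have \<tau>: "\<tau> i > 0" using pos i by blast
  have ti: "node_time \<tau> i = node_time \<tau> (i - 1) + \<tau> i" using i by (simp add: node_time_stage)
  have "\<Theta> i (h e) - \<Theta> i (h s) = \<tau> i * b * (h e - h s)"
  proof (rule stage_ode_constant_rate[OF ode])
    show "0 \<le> h s" "h s \<le> h e" "h e \<le> 1"
      using assms(5-7) \<tau> ti by (auto simp: h_def divide_simps)
    fix x assume x: "x \<in> {h s..<h e}"
    define r where "r = node_time \<tau> (i - 1) + x * \<tau> i"
    have r: "r \<in> {s..<e}" "h r = x"
      using x \<tau> by (auto simp: r_def h_def field_simps)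
    have "concatenate N \<tau> U r = U i (h r)"
      unfolding h_def using r assms(5-7) by (intro concatenate_stage[OF pos i]) auto
    then show "\<tau> i * U i x = \<tau> i * b" using u[OF r(1)] r(2) by simp
  qed
  also have "\<tau> i * b * (h e - h s) = b * (e - s)"
    using \<tau> by (simp add: h_def field_simps)
  finally have "\<Theta> i (h e) - \<Theta> i (h s) = b * (e - s)" .
  moreover have "concatenate N \<tau> \<Theta> r = \<Theta> i (h r)"
    if "r \<in> {node_time \<tau> (i - 1)..node_time \<tau> i}" for r
    unfolding h_def using concatenate_closed_stage[where F = \<Theta>, OF pos i glue that] by simp
  ultimately show ?thesis using assms(5-7) by simp
qed

section \<open>One-sided limits and pivots of bang-bang stages\<close>

lemma right_limit_constant:
  assumes "s < e" and "\<And>r. r \<in> {s..<e} \<Longrightarrow> u r = b"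
  shows "right_limit u s = b"
proof -
  have "eventually (\<lambda>r. u r = b) (at_right s)"
    using assms by (intro eventually_at_rightI[of s e]) auto
  then have "(u \<longlongrightarrow> b) (at_right s)" by (rule tendsto_eventually)
  then show ?thesis unfolding right_limit_def by (intro tendsto_Lim) auto
qed

lemma left_limit_constant:
  assumes "s < e" and "\<And>r. r \<in> {s..<e} \<Longrightarrow> u r = b"
  shows "left_limit u e = b"
proof -
  have "eventually (\<lambda>r. u r = b) (at_left e)"
    using assms by (intro eventually_at_leftI[of s e]) auto
  then have "(u \<longlongrightarrow> b) (at_left e)" by (rule tendsto_eventually)
  then show ?thesis unfolding left_limit_def by (intro tendsto_Lim) auto
qed

text \<open>Allowing \<open>q = s\<close> makes the first arc empty, so one form covers both types;
  the sign of \<open>b\<close> covers both senses of the turn.\<close>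

definition pivot :: "real \<Rightarrow> (real \<Rightarrow> real) \<Rightarrow> real \<Rightarrow> real \<Rightarrow> real \<Rightarrow> real \<Rightarrow> bool" where
  "pivot a u s e q b \<longleftrightarrow> \<bar>b\<bar> = a \<and> s \<le> q \<and> q < e \<and> q - s \<le> pi / a \<and> e - q \<le> pi / a \<and>
     (\<forall>r\<in>{s..<q}. u r = - b) \<and> (\<forall>r\<in>{q..<e}. u r = b)"

lemma pivotD:
  assumes "pivot a u s e q b"
  shows "\<bar>b\<bar> = a" "s \<le> q" "q < e" "q - s \<le> pi / a" "e - q \<le> pi / a"
    "\<And>r. r \<in> {s..<q} \<Longrightarrow> u r = - b" "\<And>r. r \<in> {q..<e} \<Longrightarrow> u r = b"
  using assms by (auto simp: pivot_def)

lemma type_CC_pivot: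
  assumes "a > 0" "type_CC a u s m e" "m - s \<le> pi / a" "e - m \<le> pi / a"
  shows "pivot a u s e m (right_limit u m)"
proof -
  \<comment> \<open>The value \<open>c\<close> of the control after the switch is \<open>- a\<close>
    or \<open>a\<close>, which merges the two alternatives of \<open>type_CC\<close>.\<close>
  obtain c where c: "\<bar>c\<bar> = a" "s < m" "m < e" "\<And>r. r \<in> {s..<m} \<Longrightarrow> u r = - c" "\<And>r. r \<in> {m..<e} \<Longrightarrow> u r = c"
  proof -
    show thesis
      using assms(2) that[of a] that[of "- a"] \<open>a > 0\<close> unfolding type_CC_def arc_with_def by auto
  qed
  then have "right_limit u m = c" by (intro right_limit_constant[of m e])
  then show ?thesis using c assms(3,4) by (simp add: pivot_def)
qed

lemma type_C_pivot:
  assumes "a > 0" "type_C a u s e" "e - s \<le> pi / a"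
  shows "pivot a u s e s (right_limit u s)"
proof -
  obtain c where c: "\<bar>c\<bar> = a" "s < e" "\<And>r. r \<in> {s..<e} \<Longrightarrow> u r = c"
  proof -
    show thesis
      using assms(2) that[of a] that[of "- a"] \<open>a > 0\<close> unfolding type_C_def arc_with_def by auto
  qed
  then have "right_limit u s = c" by (intro right_limit_constant[of s e])
  then show ?thesis using c assms(1,3) by (simp add: pivot_def)
qed

lemma pivot_left_limit:
  assumes "pivot a u s e q b"
  shows "left_limit u e = b"
  using pivotD[OF assms] by (intro left_limit_constant[of q e]) auto

lemma pivot_right_limit:
  assumes "pivot a u s e q b"
  shows "right_limit u s = (if q = s then b else - b)"
  using pivotD[OF assms] right_limit_constant[of s e u b] right_limit_constant[of s q u "- b"]
  by auto

text \<open>The rate is \<open>b\<close> after the pivot and \<open>- b\<close> before it, where the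
  elapsed time to \<open>q\<close> is \<open>q - r\<close>; the two signs combine into the absolute
  value.\<close>

lemma pivot_angle:
  assumes piv: "pivot a u s e q b"
    and arc: "\<And>x y c. \<lbrakk>s \<le> x; x \<le> y; y \<le> e; \<And>r. r \<in> {x..<y} \<Longrightarrow> u r = c\<rbrakk>
                \<Longrightarrow> \<theta> y - \<theta> x = c * (y - x)"
    and r: "r \<in> {s..e}"
  shows "\<theta> r = \<theta> q + b * \<bar>r - q\<bar>"
proof (cases "r \<ge> q")
  case True
  then show ?thesis using arc[of q r b] pivotD[OF piv] r by (auto simp: algebra_simps)
next
  case False
  then show ?thesis using arc[of r q "- b"] pivotD[OF piv] r by (auto simp: algebra_simps)
qed

section \<open>The switching function of a single stage\<close>

text \<open>The primitive, zero at the pivot, of \<open>\<rho> * sin (\<theta> r - \<phi>)\<close>,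
  the right-hand side of the adjoint equation in polar coordinates. With \<open>r - q\<close>
  instead of its absolute value it is visibly smooth across the switch.\<close>

definition switching :: "real \<Rightarrow> real \<Rightarrow> real \<Rightarrow> real \<Rightarrow> real \<Rightarrow> real" where
  "switching a \<rho> b q r = - (\<rho> / b) * sin (a * (r - q))"

locale pivot_stage =
  fixes a \<rho> \<phi> s e q b :: real and \<theta> u :: "real \<Rightarrow> real"
  assumes a: "a > 0" and \<rho>: "\<rho> > 0"
    and piv: "pivot a u s e q b"
    and angle: "\<And>r. r \<in> {s..e} \<Longrightarrow> \<theta> r = \<theta> q + b * \<bar>r - q\<bar>"
    and \<phi>: "\<phi> = \<theta> q + sgn b * (pi / 2)"
begin

lemma b_cases: "b = a \<or> b = - a"
  using pivotD(1)[OF piv] by auto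

text \<open>Since \<open>b = sgn b * a\<close>, the difference of angles is
  \<open>sgn b * (a * \<bar>r - q\<bar> - pi / 2)\<close>, and the even cosine forgets the
  sign.\<close>

lemma cos_angle: "r \<in> {s..e} \<Longrightarrow> cos (\<theta> r - \<phi>) = sin (a * \<bar>r - q\<bar>)"
  using b_cases a by (auto simp: angle \<phi> cos_add cos_diff)

lemma sin_angle: "r \<in> {s..e} \<Longrightarrow> sin (\<theta> r - \<phi>) = - sgn b * cos (a * (r - q))"
proof -
  assume "r \<in> {s..e}"
  then have "sin (\<theta> r - \<phi>) = - sgn b * cos (a * \<bar>r - q\<bar>)"
    using b_cases a by (auto simp: angle \<phi> sin_add sin_diff)
  also have "cos (a * \<bar>r - q\<bar>) = cos (a * (r - q))"
    using a by (metis abs_mult abs_of_pos cos_abs_real)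
  finally show ?thesis .
qed

text \<open>The bound \<open>pi / a\<close> on both arcs keeps the argument in
  \<open>[0, pi]\<close>.\<close>

lemma sin_nonneg: "r \<in> {s..e} \<Longrightarrow> sin (a * \<bar>r - q\<bar>) \<ge> 0"
proof -
  assume r: "r \<in> {s..e}"
  have "\<bar>r - q\<bar> \<le> pi / a" using pivotD(2-5)[OF piv] r by auto
  then have "a * \<bar>r - q\<bar> \<le> pi" using a by (simp add: field_simps)
  then show ?thesis using a by (intro sin_ge_zero) auto
qed

text \<open>In this form the prefactor changes sign at \<open>q\<close> exactly as the control does,
  so its product with the control is \<open>- \<rho>\<close> on both arcs.\<close>

lemma switching_eq:
  "switching a \<rho> b q r = (if r \<ge> q then - (\<rho> / b) else \<rho> / b) * sin (a * \<bar>r - q\<bar>)"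
  using sin_minus[of "a * (r - q)"] by (simp add: switching_def minus_mult_right)

lemma switching_control:
  assumes "r \<in> {s..<e}"
  shows "switching a \<rho> b q r * u r = - (\<rho> * cos (\<theta> r - \<phi>))"
proof -
  have "u r = (if r \<ge> q then b else - b)"
    using pivotD(6,7)[OF piv] assms by auto
  moreover have "b \<noteq> 0" using b_cases a by auto
  ultimately show ?thesis using assms by (simp add: cos_angle switching_eq)
qed

text \<open>The control has modulus \<open>a\<close> and its product with the switching function is
  at most 0, so a nonzero switching function has the opposite sign.\<close>

lemma bang_bang:
  assumes "r \<in> {s..<e}"
  shows "(switching a \<rho> b q r < 0 \<longrightarrow> u r = a) \<and> (switching a \<rho> b q r > 0 \<longrightarrow> u r = - a)"
proof -
  have "u r = b \<or> u r = - b" using pivotD(6,7)[OF piv] assms by (cases "r \<ge> q") auto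
  then have "u r = a \<or> u r = - a" using b_cases by auto
  moreover have "switching a \<rho> b q r * u r \<le> 0"
    using assms sin_nonneg[of r] \<rho> by (simp add: switching_control cos_angle)
  ultimately show ?thesis using a by (auto simp: mult_le_0_iff)
qed

text \<open>The first two terms combine to \<open>\<rho> * cos (\<theta> r - \<phi>)\<close>, which
  the product of switching function and control cancels.\<close>

lemma hamiltonian:
  assumes "r \<in> {s..<e}"
  shows "\<rho> * cos \<phi> * cos (\<theta> r) + \<rho> * sin \<phi> * sin (\<theta> r) + switching a \<rho> b q r * u r = 0"
  using switching_control[OF assms] by (simp add: cos_diff algebra_simps)

lemma switching_derivative:
  assumes "r \<in> {s..e}"
  shows "(switching a \<rho> b q has_real_derivative \<rho> * cos \<phi> * sin (\<theta> r) - \<rho> * sin \<phi> * cos (\<theta> r))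
           (at r within A)"
proof -
  have "(switching a \<rho> b q has_real_derivative - (\<rho> / b) * (cos (a * (r - q)) * a)) (at r within A)"
    unfolding switching_def by (rule DERIV_cmult) (auto intro!: derivative_eq_intros)
  moreover have "- (\<rho> / b) * (cos (a * (r - q)) * a) = \<rho> * sin (\<theta> r - \<phi>)"
  proof -
    have "a / b = sgn b" using b_cases a by auto
    then have "\<rho> * sin (\<theta> r - \<phi>) = \<rho> * (- (a / b) * cos (a * (r - q)))"
      by (simp only: sin_angle[OF assms])
    then show ?thesis by simp
  qed
  ultimately show ?thesis by (simp add: sin_diff algebra_simps)
qed

text \<open>The derivative is \<open>\<rho> * sin (\<theta> r - \<phi>)\<close>, bounded by \<rho>
  in absolute value.\<close>

lemma switching_lipschitz: "\<rho>-lipschitz_on {s..e} (switching a \<rho> b q)"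
proof (rule bounded_derivative_imp_lipschitz[OF switching_derivative[unfolded has_field_derivative_def]])
  fix r assume "r \<in> {s..e}"
  have "\<bar>\<rho> * sin (\<theta> r - \<phi>) * x\<bar> \<le> \<rho> * \<bar>x\<bar>" for x
    using \<rho> by (simp add: abs_mult mult_left_le_one_le mult.assoc)
  then show "onorm ((*) (\<rho> * cos \<phi> * sin (\<theta> r) - \<rho> * sin \<phi> * cos (\<theta> r))) \<le> \<rho>"
    by (intro onorm_le) (simp add: sin_diff algebra_simps)
qed (use \<rho> in auto)

text \<open>The end point \<open>e\<close> lies outside the half-open stage, so the left limit takes
  the place of the control, as the node conditions require.\<close>

lemma switching_final: "switching a \<rho> b q e * left_limit u e = - (\<rho> * cos (\<theta> e - \<phi>))"
proof -
  have "b \<noteq> 0" using b_cases a by auto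
  then show ?thesis
    using pivotD[OF piv] by (simp add: pivot_left_limit[OF piv] cos_angle switching_eq)
qed

lemma switching_initial: "switching a \<rho> b q s * right_limit u s = - (\<rho> * cos (\<theta> s - \<phi>))"
proof -
  have "b \<noteq> 0" using b_cases a by auto
  then show ?thesis
    using pivotD[OF piv] by (auto simp: pivot_right_limit[OF piv] cos_angle switching_eq)
qed

end

section \<open>Gluing the stages into multipliers for the whole path\<close>

theorem theorem3:
  fixes N :: nat and a th_init th_fin :: real
    and p :: "nat \<Rightarrow> real \<times> real"
    and \<tau> t m :: "nat \<Rightarrow> real"
    and X Y \<Theta> U :: "nat \<Rightarrow> real \<Rightarrow> real"
    and \<theta> u :: "real \<Rightarrow> real"
  assumes "N \<ge> 1" and "a > 0"
    and "\<And>i. i \<in> {1..N} \<Longrightarrow> p (i - 1) \<noteq> p i"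
    and "Pmc_feasible N a p th_init th_fin \<tau> X Y \<Theta> U"
    and "t = node_time \<tau>" and "\<theta> = concatenate N \<tau> \<Theta>" and "u = concatenate N \<tau> U"
    and "\<And>i. i \<in> {1..N} \<Longrightarrow>
           (type_CC a u (t (i - 1)) (m i) (t i) \<and>
              m i - t (i - 1) \<le> pi / a \<and> t i - m i \<le> pi / a) \<or>
           (type_C a u (t (i - 1)) (t i) \<and> t i - t (i - 1) \<le> pi / a)"
    and "\<exists>\<rho> \<phi>. node_conditions N t \<theta> u \<rho> \<phi> \<and> stage_conditions N a t m \<theta> u \<rho> \<phi>"
  shows "verifies_max_principle_with 0 N a t \<theta> u"
proof -
  note t_eq = assms(5) and \<theta>_eq = assms(6) and u_eq = assms(7)
  have pos: "\<tau> j > 0" if "j \<in> {1..N}" for j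
    using assms(4) that by (auto simp: Pmc_feasible_def)
  have glue: "\<Theta> (j + 1) 0 = \<Theta> j 1" if "j \<in> {1..<N}" for j
    using assms(4) that by (auto simp: Pmc_feasible_def)
  have t_less: "t (i - 1) < t i" if "i \<in> {1..N}" for i
    using pos[OF that] that by (simp add: t_eq node_time_stage)
  obtain \<rho> \<phi> where node: "node_conditions N t \<theta> u \<rho> \<phi>" and stage: "stage_conditions N a t m \<theta> u \<rho> \<phi>"
    using assms(9) by blast

  have "\<exists>q b. pivot_stage a (\<rho> i) (\<phi> i) (t (i - 1)) (t i) q b \<theta> u" if i: "i \<in> {1..N}" for i
  proof -
    \<comment> \<open>The pivot is \<open>m i\<close> for type CC and \<open>t (i - 1)\<close> for
      type C. The prescribed \<open>\<phi> i\<close> refers to the right limit of the control at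
      that same time, which serves as final control.\<close>
    obtain q where piv: "pivot a u (t (i - 1)) (t i) q (right_limit u q)" and "\<rho> i > 0"
      and "\<phi> i = \<theta> q + sgn (right_limit u q) * (pi / 2)"
      using assms(8)[OF i] type_CC_pivot[OF \<open>a > 0\<close>] type_C_pivot[OF \<open>a > 0\<close>] stage i
      unfolding stage_conditions_def by metis
    moreover have "\<theta> r = \<theta> q + right_limit u q * \<bar>r - q\<bar>" if "r \<in> {t (i - 1)..t i}" for r
    proof (rule pivot_angle[OF piv _ that])
      fix x y c
      assume "t (i - 1) \<le> x" "x \<le> y" "y \<le> t i" "\<And>r. r \<in> {x..<y} \<Longrightarrow> u r = c"
      moreover have "stage_ode (\<Theta> i) (\<lambda>s. \<tau> i * U i s)"
        using assms(4) i by (auto simp: Pmc_feasible_def)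
      ultimately show "\<theta> y - \<theta> x = c * (y - x)"
        unfolding t_eq \<theta>_eq u_eq by (intro concatenate_arc[where \<Theta> = \<Theta> and U = U, OF pos i glue])
    qed
    ultimately have "pivot_stage a (\<rho> i) (\<phi> i) (t (i - 1)) (t i) q (right_limit u q) \<theta> u"
      using \<open>a > 0\<close> by unfold_locales
    then show ?thesis by blast
  qed
  then obtain q b where ps: "\<And>i. i \<in> {1..N} \<Longrightarrow>
      pivot_stage a (\<rho> i) (\<phi> i) (t (i - 1)) (t i) (q i) (b i) \<theta> u"
    by metis
  define G where "G i = switching a (\<rho> i) (b i) (q i)" for i

  have G_glue: "G (i + 1) (t i) = G i (t i)" if i: "i \<in> {1..<N}" for i
  proof -
    have i1: "i \<in> {1..N}" and i2: "i + 1 \<in> {1..N}" using i by auto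
    interpret A: pivot_stage a "\<rho> i" "\<phi> i" "t (i - 1)" "t i" "q i" "b i" \<theta> u
      using ps[OF i1] .
    interpret B: pivot_stage a "\<rho> (i + 1)" "\<phi> (i + 1)" "t i" "t (i + 1)" "q (i + 1)" "b (i + 1)" \<theta> u
      using ps[OF i2] by simp
    let ?l = "left_limit u (t i)" and ?r = "right_limit u (t i)"
    have l: "?l \<noteq> 0" and lr: "?r = ?l \<or> ?r = - ?l"
      using A.b_cases B.b_cases \<open>a > 0\<close>
      by (auto simp: pivot_left_limit[OF A.piv] pivot_right_limit[OF B.piv])
    \<comment> \<open>Multiplying by the nonzero left limit brings both sides into the form of the
      node conditions. At a jump the initial value of the next stage is multiplied by
      \<open>- ?r\<close>, whence the sign in the second condition.\<close>
    from lr have "G (i + 1) (t i) * ?l = G i (t i) * ?l"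
    proof
      assume eq: "?r = ?l"
      then have "G (i + 1) (t i) * ?l = - (\<rho> (i + 1) * cos (\<theta> (t i) - \<phi> (i + 1)))"
        unfolding G_def using B.switching_initial by simp
      also have "\<dots> = - (\<rho> i * cos (\<theta> (t i) - \<phi> i))"
        using node i eq by (auto simp: node_conditions_def)
      finally show ?thesis unfolding G_def using A.switching_final by simp
    next
      assume eq: "?r = - ?l"
      then have "G (i + 1) (t i) * ?l = \<rho> (i + 1) * cos (\<theta> (t i) - \<phi> (i + 1))"
        unfolding G_def using B.switching_initial by simp
      also have "\<dots> = - (\<rho> i * cos (\<theta> (t i) - \<phi> i))"
        using node i eq by (auto simp: node_conditions_def)
      finally show ?thesis unfolding G_def using A.switching_final by simp
    qed
    then show ?thesis using l by simp
  qed

  \<comment> \<open>Each \<open>G i\<close> already uses the original time; the inner affine map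
    undoes the rescaling that \<open>concatenate\<close> applies.\<close>
  define l3 where "l3 = concatenate N \<tau> (\<lambda>i s. G i (t (i - 1) + s * \<tau> i))"
  have l3: "l3 r = G i r" if i: "i \<in> {1..N}" and r: "r \<in> {t (i - 1)..t i}" for i r
  proof -
    have "l3 r = G i (t (i - 1) + ((r - t (i - 1)) / \<tau> i) * \<tau> i)"
      unfolding l3_def t_eq
    proof (rule concatenate_closed_stage[OF pos i])
      fix j assume "j \<in> {1..<N}"
      then show "G (j + 1) (node_time \<tau> (j + 1 - 1) + 0 * \<tau> (j + 1)) = G j (node_time \<tau> (j - 1) + 1 * \<tau> j)"
        using G_glue[of j] node_time_stage[of j \<tau>] by (simp add: t_eq)
    qed (use r t_eq in auto)
    then show ?thesis using pos[OF i] by simp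
  qed
  have l3_lipschitz: "(\<rho> i)-lipschitz_on {t (i - 1)..t i} l3" if i: "i \<in> {1..N}" for i
    using pivot_stage.switching_lipschitz[OF ps[OF i]] l3[OF i]
    by (auto simp: G_def intro: lipschitz_on_transform)
  have "multipliers N a t \<theta> u 0 (\<lambda>i. \<rho> i * cos (\<phi> i)) (\<lambda>i. \<rho> i * sin (\<phi> i)) l3"
    unfolding multipliers_def
  proof (intro conjI ballI)
    have "t 0 = 0" by (simp add: t_eq)
    then show "continuous_on {0..t N} l3"
      using continuous_on_consecutive[of N t l3] t_less l3_lipschitz
      by (metis less_imp_le lipschitz_on_continuous_on)
  next
    fix i assume i: "i \<in> {1..N}"
    interpret pivot_stage a "\<rho> i" "\<phi> i" "t (i - 1)" "t i" "q i" "b i" \<theta> u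
      using ps[OF i] .
    show "\<exists>L. L-lipschitz_on {t (i - 1)..t i} l3" using l3_lipschitz[OF i] by blast
    show "AE r in lebesgue_on {t (i - 1)..<t i}. (l3 r < 0 \<longrightarrow> u r = a) \<and> (l3 r > 0 \<longrightarrow> u r = - a)"
      using bang_bang l3[OF i] by (intro AE_I2) (auto simp: G_def)
    fix r
    show "0 + \<rho> i * cos (\<phi> i) * cos (\<theta> r) + \<rho> i * sin (\<phi> i) * sin (\<theta> r) + l3 r * u r = 0"
      if r: "r \<in> {t (i - 1)..<t i}"
      using hamiltonian[OF r] l3[OF i] r by (simp add: G_def)
    assume r: "r \<in> {t (i - 1)..t i}"
    \<comment> \<open>Nontriviality comes from \<open>\<rho> i > 0\<close>: the two constants never
      vanish together, even where \<open>l3\<close> is zero.\<close>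
    have "cos (\<phi> i) \<noteq> 0 \<or> sin (\<phi> i) \<noteq> 0"
      using sin_zero_abs_cos_one[of "\<phi> i"] by auto
    then show "(0, \<rho> i * cos (\<phi> i), \<rho> i * sin (\<phi> i), l3 r) \<noteq> (0, 0, 0, 0)"
      using \<rho> by auto
    show "(l3 has_real_derivative \<rho> i * cos (\<phi> i) * sin (\<theta> r) - \<rho> i * sin (\<phi> i) * cos (\<theta> r))
            (at r within {t (i - 1)..t i})"
      by (rule has_field_derivative_transform_within[OF switching_derivative[OF r] zero_less_one r])
        (simp add: l3[OF i] G_def)
  qed simp
  then show ?thesis unfolding verifies_max_principle_with_def by blast
qed

end
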